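(* Let $P\subset\mathbb{R}^d$ be a smooth $d$-dimensional polytope, let $f_0$ be the number of vertices of $P$, let $b_2:=|\partial(2P)\cap\mathbb{Z}^d|$, and suppose $z=-1/2+\beta i\in\mathbb{C}$ (with $\beta\in\mathbb{R}$) is a root of the Ehrhart polynomial $L_P$. Then: (i) if $d=2$, $\beta^2=-\frac14+\frac{2}{f_0}$; (ii) if $d=3$, either $\beta=0$ or $\beta^2=-\frac14+\frac{6}{f_0-2}$; (iii) if $d=4$, for some choice of sign, $$\beta^2=-\frac{17}{4}+\frac{3b_2}{b_2-2f_0}\pm\sqrt{1-\frac{12(f_0+2)}{b_2-2f_0}+\frac{36f_0^2}{(b_2-2f_0)^2}};$$ (iv) if $d=5$, either $\beta=0$ or, for some choice of sign, $$\beta^2=-\frac54+\frac{10(f_0-2)}{6+b_2-4f_0}\pm\sqrt{1-\frac{20(f_0+4)}{6+b_2-4f_0}+\frac{100(f_0-2)^2}{(6+b_2-4f_0)^2}}.$$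
   Context: A $d$-dimensional convex lattice polytope $P\subset\mathbb{R}^d$ is called smooth if it contains the origin in its interior and the vertices of every facet of $P$ form a $\mathbb{Z}$-basis of $\mathbb{Z}^d$. The Ehrhart polynomial is $L_P(m):=|mP\cap\mathbb{Z}^d|$, a polynomial in $m$ of degree $d$. $\partial(2P)$ denotes the boundary of the dilate $2P$. *)

theory Defs
  imports "HOL-Analysis.Analysis" "HOL-Computational_Algebra.Polynomial"
begin

definition int_lattice :: "(real ^ 'n) set" where
  "int_lattice = {x. \<forall>i. x $ i \<in> \<int>}"

(* real ^ 'n as a module over the integers; linear independence and span below are with
   respect to integer coefficients. *)
global_interpretation int_module: module "\<lambda>(k::int) (x::real ^ 'n). of_int k *\<^sub>R x"
  defines int_span = int_module.span
    and int_dependent = int_module.dependent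
  by unfold_locales (simp_all add: algebra_simps)

definition is_int_basis :: "(real ^ 'n) set \<Rightarrow> (real ^ 'n) set \<Rightarrow> bool" where
  "is_int_basis B M \<longleftrightarrow> \<not> int_dependent B \<and> int_span B = M"

definition vertices :: "(real ^ 'n) set \<Rightarrow> (real ^ 'n) set" where
  "vertices P = {v. v extreme_point_of P}"

definition lattice_polytope :: "(real ^ 'n) set \<Rightarrow> bool" where
  "lattice_polytope P \<longleftrightarrow> polytope P \<and> vertices P \<subseteq> int_lattice"

definition smooth_polytope :: "(real ^ 'n) set \<Rightarrow> bool" where
  "smooth_polytope P \<longleftrightarrow>
     lattice_polytope P \<and> aff_dim P = int CARD('n) \<and> 0 \<in> interior P \<and>
     (\<forall>F. F facet_of P \<longrightarrow> is_int_basis (vertices F) int_lattice)"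

definition dilate :: "nat \<Rightarrow> (real ^ 'n) set \<Rightarrow> (real ^ 'n) set" where
  "dilate m P = (\<lambda>x. real m *\<^sub>R x) ` P"

(* A polynomial is determined by its values at the positive integers, so the description is
   unique; it denotes a polynomial whenever P is a lattice polytope (Ehrhart's theorem). *)
definition ehrhart_poly :: "(real ^ 'n) set \<Rightarrow> real poly" where
  "ehrhart_poly P =
     (THE p. \<forall>m::nat. m \<ge> 1 \<longrightarrow> poly p (real m) = real (card (dilate m P \<inter> int_lattice)))"

end

theory Submission
  imports Defs
begin

text \<open>
  The cones over the facets of \<open>P\<close> are unimodular and cover space, and they can be made disjoint by
  dropping part of their boundary: for a generic direction \<open>y\<close>, a point \<open>x\<close> is assigned to the
  unique cone whose interior contains \<open>x + e y\<close> for all small \<open>e > 0\<close>. If \<open>k(F)\<close> of the coordinates of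
  \<open>y\<close> in the basis given by the facet \<open>F\<close> are negative, the half-open cone of \<open>F\<close> contributes
  \<open>(m + d - k(F)) choose d\<close> lattice points to \<open>m P\<close>. Hence the Ehrhart polynomial \<open>L\<close> has degree exactly
  \<open>d\<close>, and comparing the directions \<open>y\<close> and \<open>- y\<close>, for which \<open>k(F)\<close> becomes \<open>d - k(F)\<close>, gives
  \<open>L(- 1 - t) = (- 1)^d L(t)\<close>. For \<open>d \<le> 5\<close> this symmetry and the values \<open>L(0) = 1\<close>,
  \<open>L(1) = 1 + f0\<close>, \<open>L(2) = 1 + f0 + b2\<close> determine \<open>L\<close>; up to the factor \<open>2 t + 1\<close> for odd \<open>d\<close> it is a
  polynomial in \<open>t (t + 1)\<close> of degree at most two, and \<open>t (t + 1) = - (\<beta>^2 + 1/4)\<close> at the given root.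
\<close>

subsection \<open>Dual lattice bases\<close>

text \<open>Expanding the unit vectors in \<open>B\<close> with integer coefficients gives integer
  vectors \<open>w b\<close>, and by linearity \<open>x \<bullet> w b\<close> serves as the
  coefficient of \<open>b\<close> in every \<open>x\<close>. Integer independence is applied only to
  the elements of \<open>B\<close>, whose coefficients are integers.\<close>

lemma int_basis_dual:
  fixes B :: "(real ^ 'n) set"
  assumes fin: "finite B" and bas: "is_int_basis B int_lattice"
  obtains w where "\<And>b. b \<in> B \<Longrightarrow> w b \<in> int_lattice"
    and "\<And>b c. b \<in> B \<Longrightarrow> c \<in> B \<Longrightarrow> c \<bullet> w b = (if b = c then 1 else 0)"
    and "\<And>x. (\<Sum>b\<in>B. (x \<bullet> w b) *\<^sub>R b) = x"
proof -
  have ind: "\<not> int_dependent B" and sp: "int_span B = int_lattice"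
    using bas by (auto simp: is_int_basis_def)
  have "\<exists>u. axis i 1 = (\<Sum>b\<in>B. of_int (u b) *\<^sub>R b)" for i :: 'n
  proof -
    have "axis i 1 \<in> int_span B"
      unfolding sp by (simp add: int_lattice_def axis_def)
    then show ?thesis
      using int_module.span_finite[OF fin] by auto
  qed
  then obtain M where M: "\<And>i::'n. axis i 1 = (\<Sum>b\<in>B. of_int (M i b) *\<^sub>R b)"
    by metis
  define w where "w b = (\<chi> i. real_of_int (M i b))" for b
  have w_lat: "w b \<in> int_lattice" for b
    by (simp add: w_def int_lattice_def)
  have expand: "(\<Sum>b\<in>B. (x \<bullet> w b) *\<^sub>R b) = x" for x
  proof -
    have "(\<Sum>b\<in>B. (x \<bullet> w b) *\<^sub>R b) = (\<Sum>b\<in>B. \<Sum>i\<in>UNIV. (x $ i) *\<^sub>R (of_int (M i b) *\<^sub>R b))"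
      by (simp add: w_def inner_vec_def scaleR_sum_left)
    also have "\<dots> = (\<Sum>i\<in>UNIV. (x $ i) *\<^sub>R axis i 1)"
      by (subst sum.swap) (simp add: M scaleR_sum_right)
    also have "\<dots> = x"
      using basis_expansion[of x] by (simp add: scalar_mult_eq_scaleR)
    finally show ?thesis .
  qed
  have dual: "c \<bullet> w b = (if b = c then 1 else 0)" if "b \<in> B" "c \<in> B" for b c
  proof -
    have "c \<in> int_lattice"
      using \<open>c \<in> B\<close> int_module.span_base[of c B] sp by simp
    then have "c \<bullet> w b' \<in> \<int>" for b'
      by (auto simp: inner_vec_def int_lattice_def w_def intro!: Ints_sum)
    moreover define k where "k b' = \<lfloor>c \<bullet> w b'\<rfloor>" for b'
    ultimately have k: "c \<bullet> w b' = of_int (k b')" for b'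
      unfolding k_def by (metis Ints_cases floor_of_int)
    \<comment> \<open>The difference of two integer expansions of \<open>c\<close>, the one with
      coefficients \<open>k b'\<close> and the trivial one, is an integer relation on
      \<open>B\<close>.\<close>
    have "(\<Sum>b'\<in>B. of_int (k b' - (if b' = c then 1 else 0)) *\<^sub>R b') = 
        (\<Sum>b'\<in>B. (c \<bullet> w b') *\<^sub>R b') - (\<Sum>b'\<in>B. if b' = c then c else 0)"
      unfolding sum_subtractf[symmetric] by (intro sum.cong) (simp_all add: k scaleR_left_diff_distrib)
    also have "\<dots> = 0"
      using fin \<open>c \<in> B\<close> by (simp add: expand)
    finally have "k b - (if b = c then 1 else 0) = 0"
      by (rule int_module.independentD[OF ind fin order_refl _ \<open>b \<in> B\<close>])
    then show ?thesis by (auto simp: k split: if_splits)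
  qed
  show ?thesis by (rule that[of w]) (use w_lat dual expand in auto)
qed

text \<open>Pairing a linear relation with \<open>w b\<close> isolates one coefficient, so a dual
  system turns \<open>B\<close> into a real basis.\<close>

lemma card_eq_CARD_if_dual:
  fixes B :: "(real ^ 'n) set"
  assumes "finite B"
    and dual: "\<And>b c. b \<in> B \<Longrightarrow> c \<in> B \<Longrightarrow> c \<bullet> w b = (if b = c then 1 else 0)"
    and expand: "\<And>x. (\<Sum>b\<in>B. (x \<bullet> w b) *\<^sub>R b) = x"
  shows "card B = CARD('n)"
proof -
  have "independent B"
  proof (subst independent_explicit, intro conjI allI impI ballI)
    fix c b assume 0: "(\<Sum>v\<in>B. c v *\<^sub>R v) = 0" and "b \<in> B"
    have "0 = (\<Sum>v\<in>B. c v *\<^sub>R v) \<bullet> w b" by (simp add: 0)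
    also have "\<dots> = (\<Sum>v\<in>B. if b = v then c b else 0)"
      unfolding inner_sum_left by (intro sum.cong) (use dual \<open>b \<in> B\<close> in auto)
    also have "\<dots> = c b" using \<open>b \<in> B\<close> assms(1) by simp
    finally show "c b = 0" by simp
  qed (fact assms(1))
  moreover have "x \<in> span B" for x
    by (subst expand[of x, symmetric]) (intro span_sum span_scale span_base)
  then have "span B = UNIV" by auto
  ultimately have "card B = DIM(real ^ 'n)"
    by (metis dim_UNIV dim_eq_card_independent dim_span)
  then show ?thesis by simp
qed

subsection \<open>Counting bounded compositions\<close>

text \<open>Coordinate vectors of the lattice points of height at most \<open>m\<close> in a
  half-open unimodular cone; \<open>N\<close> marks the walls that are removed. Extensionality lets
  a function be counted by its values on \<open>B\<close> alone.\<close>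

definition bounded_sums :: "'a set \<Rightarrow> 'a set \<Rightarrow> nat \<Rightarrow> ('a \<Rightarrow> nat) set" where
  "bounded_sums B N m = {a \<in> B \<rightarrow>\<^sub>E UNIV. (\<forall>v\<in>N. a v > 0) \<and> sum a B \<le> m}"

lemma finite_bounded_sums:
  assumes "finite B" shows "finite (bounded_sums B N m)"
proof (rule finite_subset)
  show "bounded_sums B N m \<subseteq> B \<rightarrow>\<^sub>E {..m}"
  proof
    fix a assume "a \<in> bounded_sums B N m"
    then have "a \<in> extensional B" "sum a B \<le> m"
      by (auto simp: bounded_sums_def PiE_iff)
    moreover have "a v \<le> sum a B" if "v \<in> B" for v
      using that assms by (simp add: member_le_sum)
    ultimately show "a \<in> B \<rightarrow>\<^sub>E {..m}"
      by (auto simp: PiE_iff dest: order_trans)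
  qed
qed (simp add: assms finite_PiE)

text \<open>Hockey-stick summation started at \<open>c\<close>: the omitted terms with upper index
  below \<open>c\<close> are 0 because \<open>c \<le> b\<close>.\<close>

lemma sum_choose_shift:
  assumes "c \<le> b"
  shows "(\<Sum>i\<le>m. (i + c) choose b) = (m + c + 1) choose (b + 1)"
proof (induction m)
  case 0
  then show ?case using assms by (cases "c = b") (auto simp: binomial_eq_0)
qed simp

lemma card_bounded_sums_insert:
  assumes "finite B" "w \<notin> B" "N \<subseteq> insert w B"
  shows "card (bounded_sums (insert w B) N m) =
    (\<Sum>j\<in>{(if w \<in> N then 1 else 0)..m}. card (bounded_sums B (N - {w}) (m - j)))"
proof -
  let ?J = "{(if w \<in> N then 1 else 0)..m}"
  have [simp]: "v \<noteq> w" if "v \<in> B" for v using assms that by auto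
  have *: "sum (a(w := j)) B = sum a B" for a :: "'a \<Rightarrow> nat" and j
    by (intro sum.cong) auto
  have "bij_betw (\<lambda>(j, a). a(w := j)) (SIGMA j:?J. bounded_sums B (N - {w}) (m - j))
      (bounded_sums (insert w B) N m)"
  \<comment> \<open>Splitting off the value at \<open>w\<close> resets it to
    \<open>undefined\<close>, which keeps the remaining function extensional on
    \<open>B\<close>.\<close>
  proof (rule bij_betwI[where g = "\<lambda>a. (a w, a(w := undefined))"])
    show "(\<lambda>(j, a). a(w := j)) \<in> (SIGMA j:?J. bounded_sums B (N - {w}) (m - j)) \<rightarrow>
        bounded_sums (insert w B) N m"
      using assms(1,2) by (auto simp: bounded_sums_def * PiE_iff extensional_def split: if_splits)
    show "(\<lambda>a. (a w, a(w := undefined))) \<in> bounded_sums (insert w B) N m \<rightarrow>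
        (SIGMA j:?J. bounded_sums B (N - {w}) (m - j))"
      using assms(1,2) by (auto simp: bounded_sums_def * PiE_iff extensional_def Suc_le_eq split: if_splits)
    show "(\<lambda>a. (a w, a(w := undefined))) ((\<lambda>(j, a). a(w := j)) p) = p"
      if "p \<in> (SIGMA j:?J. bounded_sums B (N - {w}) (m - j))" for p
      using assms that by (auto simp: bounded_sums_def PiE_iff extensional_def fun_eq_iff)
  qed auto
  then have "card (bounded_sums (insert w B) N m) =
      card (SIGMA j:?J. bounded_sums B (N - {w}) (m - j))"
    by (simp add: bij_betw_same_card)
  also have "\<dots> = (\<Sum>j\<in>?J. card (bounded_sums B (N - {w}) (m - j)))"
    using assms by (intro card_SigmaI ballI finite_bounded_sums) auto
  finally show ?thesis .
qed

text \<open>Subtracting 1 at each element of \<open>N\<close> reduces this to stars and bars with a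
  slack variable; for \<open>m < card N\<close> both sides are 0. The induction sums out one
  coordinate by the hockey-stick identity.\<close>

lemma card_bounded_sums:
  fixes B :: "'a set"
  assumes "finite B" "N \<subseteq> B"
  shows "card (bounded_sums B N m) = (m + card B - card N) choose card B"
  using assms
proof (induction B arbitrary: N m)
  case empty
  have "bounded_sums ({} :: 'a set) {} m = {\<lambda>_. undefined}"
    by (auto simp: bounded_sums_def)
  with empty show ?case by simp
next
  case (insert w B)
  define b where "b = card B"
  define c where "c = card B - card (N - {w})"
  have fN: "finite N" using insert.prems insert.hyps(1) by (meson finite.insertI finite_subset)
  have sub: "N - {w} \<subseteq> B" using insert.prems by auto
  have le: "card (N - {w}) \<le> card B" using sub insert.hyps by (simp add: card_mono)
  have ins: "card (insert w B) = Suc (card B)" using insert.hyps by simp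
  have IH: "card (bounded_sums B (N - {w}) i) = (i + c) choose b" for i
    using insert.IH[OF sub] le by (simp add: b_def c_def)
  have c: "c \<le> b" by (simp add: b_def c_def)
  show ?case
  proof (cases "w \<in> N")
    case False
    have "card (bounded_sums (insert w B) N m) = (\<Sum>j\<in>{0..m}. (m - j + c) choose b)"
      unfolding card_bounded_sums_insert[OF insert.hyps insert.prems] IH using False by simp
    also have "\<dots> = (\<Sum>i\<le>m. (i + c) choose b)"
      by (rule sum.reindex_bij_witness[of _ "\<lambda>i. m - i" "\<lambda>i. m - i"]) auto
    also note sum_choose_shift[OF c]
    finally have "card (bounded_sums (insert w B) N m) = (m + c + 1) choose (b + 1)" .
    moreover have "m + c + 1 = m + card (insert w B) - card N"
      using False le by (simp add: c_def ins)
    ultimately show ?thesis by (simp only: ins b_def Suc_eq_plus1)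
  next
    case True
    then have cN: "card N = Suc (card (N - {w}))" by (rule card.remove[OF fN])
    show ?thesis
    proof (cases m)
      \<comment> \<open>No positive value fits at \<open>w\<close>, and the upper index of the
        binomial coefficient falls below the lower one.\<close>
      case 0
      have "card (bounded_sums (insert w B) N m) = 0"
        unfolding card_bounded_sums_insert[OF insert.hyps insert.prems] using True 0 by simp
      moreover have "m + card (insert w B) - card N < card (insert w B)"
        using 0 cN by (simp add: ins)
      ultimately show ?thesis by (simp only: binomial_eq_0)
    next
      case (Suc n)
      have "card (bounded_sums (insert w B) N m) = (\<Sum>j\<in>{1..m}. (m - j + c) choose b)"
        unfolding card_bounded_sums_insert[OF insert.hyps insert.prems] IH using True by simp
      \<comment> \<open>Starting at 1 instead of 0 shortens the sum by one term, which accounts for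
        the contribution of \<open>w\<close> to \<open>card N\<close>.\<close>
      also have "\<dots> = (\<Sum>i\<le>n. (i + c) choose b)"
        by (rule sum.reindex_bij_witness[of _ "\<lambda>i. m - i" "\<lambda>i. m - i"]) (auto simp: Suc)
      also note sum_choose_shift[OF c]
      finally have "card (bounded_sums (insert w B) N m) = (n + c + 1) choose (b + 1)" .
      moreover have "n + c + 1 = m + card (insert w B) - card N"
        using cN le by (simp add: c_def Suc ins)
      ultimately show ?thesis by (simp only: ins b_def Suc_eq_plus1)
    qed
  qed
qed

section \<open>Binomial coefficients as polynomials in the upper index\<close>

definition choose_poly :: "nat \<Rightarrow> nat \<Rightarrow> real poly" where
  "choose_poly d k = smult (1 / fact d) (\<Prod>i<d. [:real k - real i, 1:])"

lemma poly_choose_poly: "poly (choose_poly d k) x = (x + real k) gchoose d"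
  by (simp add: choose_poly_def gbinomial_prod_rev poly_prod lessThan_atLeast0 algebra_simps)

lemma degree_prod_linear:
  "degree (\<Prod>i<d. [:real k - real i, 1:]) = d"
  by (subst degree_prod_eq_sum_degree) auto

lemma degree_choose_poly_le: "degree (choose_poly d k) \<le> d"
  by (simp add: choose_poly_def degree_prod_linear)

lemma coeff_choose_poly: "coeff (choose_poly d k) d = 1 / fact d"
proof -
  have "lead_coeff (\<Prod>i<d. [:real k - real i, 1:]) = 1"
    by (subst lead_coeff_prod) simp
  then show ?thesis by (simp add: choose_poly_def degree_prod_linear)
qed

text \<open>Upper negation sends the top \<open>- 1 - x + (d - k)\<close> to \<open>x + k\<close>.
  This is the term-by-term source of the symmetry of the Ehrhart polynomial.\<close>

lemma poly_choose_poly_reflect: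
  assumes "k \<le> d"
  shows "poly (choose_poly d (d - k)) (- 1 - x) = (- 1) ^ d * poly (choose_poly d k) x"
  using assms gbinomial_negated_upper[of "- 1 - x + real (d - k)" d]
  by (simp add: poly_choose_poly of_nat_diff algebra_simps)

text \<open>Gives the uniqueness behind the definite description in \<open>ehrhart_poly\<close>:
  agreement at more points than either degree suffices.\<close>

lemma poly_eqI_nat:
  fixes p q :: "real poly"
  assumes "\<And>m::nat. m \<ge> 1 \<Longrightarrow> poly p (real m) = poly q (real m)"
  shows "p = q"
proof (rule poly_eqI_degree[where A = "real ` {1..Suc (max (degree p) (degree q))}"])
  show "\<And>x. x \<in> real ` {1..Suc (max (degree p) (degree q))} \<Longrightarrow> poly p x = poly q x"
    using assms by auto
qed (simp_all add: card_image)

subsection \<open>The fan of a smooth polytope\<close>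

locale smooth =
  fixes P :: "(real ^ 'n) set"
  assumes smooth: "smooth_polytope P"
begin

definition facets :: "(real ^ 'n) set set" where
  "facets = {F. F facet_of P}"

text \<open>The choice is meaningful for facets, where \<open>int_basis_dual\<close> provides a
  witness.\<close>

definition dual :: "(real ^ 'n) set \<Rightarrow> real ^ 'n \<Rightarrow> real ^ 'n" where
  "dual F = (SOME w. (\<forall>b\<in>vertices F. w b \<in> int_lattice) \<and>
     (\<forall>b\<in>vertices F. \<forall>c\<in>vertices F. c \<bullet> w b = (if b = c then 1 else 0)) \<and>
     (\<forall>x. (\<Sum>b\<in>vertices F. (x \<bullet> w b) *\<^sub>R b) = x))"

definition coord :: "(real ^ 'n) set \<Rightarrow> real ^ 'n \<Rightarrow> real ^ 'n \<Rightarrow> real" where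
  "coord F v x = x \<bullet> dual F v"

text \<open>For a facet \<open>F\<close> this is the linear form with value 1 on \<open>F\<close>;
  on the cone over \<open>F\<close> it is the gauge of \<open>P\<close>.\<close>

definition height :: "(real ^ 'n) set \<Rightarrow> real ^ 'n \<Rightarrow> real" where
  "height F x = (\<Sum>v\<in>vertices F. coord F v x)"

lemma polytope: "polytope P" and lattice_vertices: "vertices P \<subseteq> int_lattice"
  and zero_interior: "0 \<in> interior P"
  and basis: "F \<in> facets \<Longrightarrow> is_int_basis (vertices F) int_lattice"
  using smooth by (auto simp: smooth_polytope_def lattice_polytope_def facets_def)

lemma zero_in: "0 \<in> P"
  using zero_interior interior_subset by blast

lemma convex: "convex P"
  by (simp add: polytope polytope_imp_convex)

lemma polyhedron: "polyhedron P"
  by (simp add: polytope polytope_imp_polyhedron)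

lemma frontier_eq: "frontier P = \<Union>facets"
proof -
  have "rel_interior P = interior P"
    using zero_interior rel_interior_nonempty_interior by blast
  then have "frontier P = rel_frontier P"
    by (simp add: frontier_def rel_frontier_def)
  then show ?thesis
    by (simp add: rel_frontier_of_polyhedron[OF polyhedron] facets_def)
qed

lemma finite_facets: "finite facets"
  unfolding facets_def by (rule finite_polytope_facets[OF polytope])

context
  fixes F assumes F: "F \<in> facets"
begin

lemma facet_face: "F face_of P"
  using F by (simp add: facets_def facet_of_def)

lemma facet_hull: "F = convex hull (vertices F)"
  unfolding vertices_def
  by (rule Krein_Milman_Minkowski)
     (use face_of_polytope_polytope[OF polytope facet_face] in
       \<open>auto simp: polytope_imp_compact polytope_imp_convex\<close>)

lemma finite_vertices: "finite (vertices F)"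
  unfolding vertices_def
  by (rule finite_polyhedron_extreme_points)
     (use face_of_polytope_polytope[OF polytope facet_face] in \<open>simp add: polytope_imp_polyhedron\<close>)

lemma vertices_facet_subset: "vertices F \<subseteq> vertices P"
  using extreme_point_of_face[OF facet_face] by (auto simp: vertices_def)

lemma dual_spec:
  "(\<forall>b\<in>vertices F. dual F b \<in> int_lattice) \<and>
     (\<forall>b\<in>vertices F. \<forall>c\<in>vertices F. c \<bullet> dual F b = (if b = c then 1 else 0)) \<and>
     (\<forall>x. (\<Sum>b\<in>vertices F. (x \<bullet> dual F b) *\<^sub>R b) = x)"
proof -
  have "\<exists>w. (\<forall>b\<in>vertices F. w b \<in> int_lattice) \<and>
     (\<forall>b\<in>vertices F. \<forall>c\<in>vertices F. c \<bullet> w b = (if b = c then 1 else 0)) \<and>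
     (\<forall>x. (\<Sum>b\<in>vertices F. (x \<bullet> w b) *\<^sub>R b) = x)"
    by (rule int_basis_dual[OF finite_vertices basis[OF F]], rule exI, intro conjI ballI allI)
  from someI_ex[OF this] show ?thesis
    unfolding dual_def .
qed

lemma coord_vertex:
  "v \<in> vertices F \<Longrightarrow> u \<in> vertices F \<Longrightarrow> coord F v u = (if v = u then 1 else 0)"
  using dual_spec by (simp add: coord_def)

lemma coord_expand: "(\<Sum>v\<in>vertices F. coord F v x *\<^sub>R v) = x"
  using dual_spec by (simp add: coord_def)

lemma card_vertices: "card (vertices F) = CARD('n)"
  by (rule card_eq_CARD_if_dual[OF finite_vertices, of "dual F"]) (use dual_spec in auto)

lemma coord_Ints:
  assumes "v \<in> vertices F" "x \<in> int_lattice"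
  shows "coord F v x \<in> \<int>"
proof -
  have "dual F v \<in> int_lattice" using dual_spec assms by blast
  then show ?thesis
    using assms(2) by (auto simp: coord_def inner_vec_def int_lattice_def intro!: Ints_sum)
qed

lemma dual_nonzero:
  assumes "v \<in> vertices F" shows "dual F v \<noteq> 0"
proof
  assume "dual F v = 0"
  with coord_vertex[OF assms assms] show False by (simp add: coord_def)
qed

lemma coord_combination:
  assumes "v \<in> vertices F"
  shows "coord F v (\<Sum>u\<in>vertices F. c u *\<^sub>R u) = c v"
proof -
  have "coord F v (\<Sum>u\<in>vertices F. c u *\<^sub>R u) = (\<Sum>u\<in>vertices F. if v = u then c v else 0)"
    unfolding coord_def inner_sum_left
    by (intro sum.cong) (use coord_vertex[OF assms] in \<open>auto simp: coord_def\<close>)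
  then show ?thesis using assms finite_vertices by simp
qed

end

lemma coord_add: "coord F v (x + y) = coord F v x + coord F v y"
  and coord_scale: "coord F v (c *\<^sub>R x) = c * coord F v x"
  and coord_zero [simp]: "coord F v 0 = 0"
  and coord_minus: "coord F v (- x) = - coord F v x"
  by (simp_all add: coord_def inner_left_distrib)

lemma height_scale: "height F (c *\<^sub>R x) = c * height F x"
  by (simp add: height_def coord_scale sum_distrib_left)

lemma height_zero [simp]: "height F 0 = 0"
  by (simp add: height_def)

text \<open>The vertices of \<open>F\<close> are a basis, so a form that is constant on them is a
  multiple of the height.\<close>

lemma linear_form_eq_height:
  assumes "F \<in> facets" "\<And>v. v \<in> vertices F \<Longrightarrow> h \<bullet> v = c"
  shows "h \<bullet> x = c * height F x"
proof -
  have "h \<bullet> x = h \<bullet> (\<Sum>v\<in>vertices F. coord F v x *\<^sub>R v)"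
    by (simp add: coord_expand[OF assms(1)])
  also have "\<dots> = (\<Sum>v\<in>vertices F. coord F v x * c)"
    using assms(2) by (simp add: inner_sum_right)
  finally show ?thesis by (simp add: height_def sum_distrib_left mult.commute)
qed

text \<open>A supporting form of \<open>F\<close> takes the constant value \<open>b\<close> on its
  vertices, hence equals \<open>b\<close> times the height. The origin being interior gives
  \<open>b > 0\<close>, so one may divide by \<open>b\<close>.\<close>

lemma facet_halfspace:
  assumes F: "F \<in> facets"
  shows "F = {x \<in> P. height F x = 1}" and "x \<in> P \<Longrightarrow> height F x \<le> 1"
proof -
  obtain a b where ab: "P \<subseteq> {x. a \<bullet> x \<le> b}" "F = P \<inter> {x. a \<bullet> x = b}"
    using facet_face[OF F] exposed_face_of_polyhedron[OF polyhedron, of F]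
    unfolding exposed_face_of_def by blast
  have ne: "F \<noteq> {}" "F \<noteq> P"
    using F by (auto simp: facets_def facet_of_def)
  have hb: "a \<bullet> x = b * height F x" for x
    by (rule linear_form_eq_height[OF F])
       (use ab(2) in \<open>auto simp: vertices_def extreme_point_of_def\<close>)
  have "b > 0"
  proof (cases "a = 0")
    case True
    then show ?thesis using ab ne by auto
  next
    case False
    obtain e where e: "e > 0" "ball 0 e \<subseteq> P"
      using zero_interior mem_interior by blast
    \<comment> \<open>The multiple of \<open>a\<close> with norm \<open>e / 2\<close> lies in the
      ball, and \<open>a\<close> is strictly positive on it.\<close>
    define c where "c = e / (2 * norm a)"
    have c: "c > 0" using e False by (simp add: c_def)
    have "c *\<^sub>R a \<in> ball 0 e" using e False by (simp add: c_def)
    then have "c *\<^sub>R a \<in> P" using e(2) by blast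
    then have "a \<bullet> (c *\<^sub>R a) \<le> b" using ab(1) by blast
    moreover have "a \<bullet> (c *\<^sub>R a) > 0" using c False by simp
    ultimately show ?thesis by linarith
  qed
  then have "a \<bullet> x = b \<longleftrightarrow> height F x = 1" "a \<bullet> x \<le> b \<longleftrightarrow> height F x \<le> 1" for x
    by (simp_all add: hb)
  with ab show "F = {x \<in> P. height F x = 1}" and "x \<in> P \<Longrightarrow> height F x \<le> 1"
    by blast+
qed

section \<open>The cones over the facets cover space and have disjoint interiors\<close>

definition cone_of :: "(real ^ 'n) set \<Rightarrow> (real ^ 'n) set" where
  "cone_of F = {x. \<forall>v\<in>vertices F. coord F v x \<ge> 0}"

lemma cone_of_scale: "c \<ge> 0 \<Longrightarrow> x \<in> cone_of F \<Longrightarrow> c *\<^sub>R x \<in> cone_of F"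
  by (simp add: cone_of_def coord_scale)

lemma height_nonneg: "x \<in> cone_of F \<Longrightarrow> height F x \<ge> 0"
  by (simp add: cone_of_def height_def sum_nonneg)

lemma height_eq_0:
  assumes "F \<in> facets" "x \<in> cone_of F" "height F x = 0"
  shows "x = 0"
proof -
  have "\<forall>v\<in>vertices F. coord F v x = 0"
    using assms by (simp add: height_def cone_of_def sum_nonneg_eq_0_iff finite_vertices)
  then show ?thesis
    using coord_expand[OF assms(1), of x] by simp
qed

lemma facet_subset_cone:
  assumes F: "F \<in> facets" and x: "x \<in> F"
  shows "x \<in> cone_of F"
proof -
  have "x \<in> convex hull vertices F"
    using x facet_hull[OF F] by simp
  then obtain c where c: "\<And>v. v \<in> vertices F \<Longrightarrow> c v \<ge> 0" "(\<Sum>v\<in>vertices F. c v *\<^sub>R v) = x"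
    unfolding convex_hull_finite[OF finite_vertices[OF F]] by auto
  then show ?thesis
    using coord_combination[OF F, of _ c] by (simp add: cone_of_def)
qed

text \<open>For \<open>s = height F x > 0\<close> the point \<open>x / s\<close> is a convex
  combination of vertices of \<open>F\<close>, and for \<open>s \<le> 1\<close> the point
  \<open>x\<close> lies on the segment from the origin to it. The converse is the facet
  inequality.\<close>

lemma in_P_iff:
  assumes F: "F \<in> facets" and x: "x \<in> cone_of F"
  shows "x \<in> P \<longleftrightarrow> height F x \<le> 1"
proof
  assume le: "height F x \<le> 1"
  show "x \<in> P"
  proof (cases "height F x = 0")
    case True
    then show ?thesis using height_eq_0[OF F x] zero_in by simp
  next
    case False
    define s where "s = height F x"
    have s: "s > 0" "s \<le> 1" using height_nonneg[OF x] False le by (auto simp: s_def)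
    have "(\<Sum>v\<in>vertices F. (coord F v x / s) *\<^sub>R v) \<in> F"
    proof (subst (2) facet_hull[OF F], rule convex_sum[OF finite_vertices[OF F] convex_convex_hull])
      show "(\<Sum>v\<in>vertices F. coord F v x / s) = 1"
        using s by (simp add: s_def height_def flip: sum_divide_distrib)
      show "0 \<le> coord F v x / s" if "v \<in> vertices F" for v
        using x s that by (simp add: cone_of_def)
    qed (simp add: hull_inc)
    moreover have "(\<Sum>v\<in>vertices F. (coord F v x / s) *\<^sub>R v) = x /\<^sub>R s"
      by (subst (2) coord_expand[OF F, of x, symmetric])
         (simp add: scaleR_sum_right divide_inverse_commute)
    ultimately have "x /\<^sub>R s \<in> P"
      using facet_halfspace(1)[OF F] by auto
    then have "s *\<^sub>R (x /\<^sub>R s) + (1 - s) *\<^sub>R 0 \<in> P"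
      using s by (intro convexD[OF convex _ zero_in]) auto
    then show ?thesis using s by simp
  qed
qed (rule facet_halfspace(2)[OF F])

lemma in_dilate_iff:
  assumes F: "F \<in> facets" and x: "x \<in> cone_of F"
  shows "x \<in> dilate m P \<longleftrightarrow> height F x \<le> real m"
proof (cases "m = 0")
  case True
  have "dilate m P = {0}" using True zero_in by (auto simp: dilate_def)
  moreover have "x = 0 \<longleftrightarrow> height F x \<le> 0"
    using height_nonneg[OF x] height_eq_0[OF F x] height_zero[of F] by (metis order.antisym order.refl)
  ultimately show ?thesis using True by simp
next
  case False
  then have "x \<in> dilate m P \<longleftrightarrow> x /\<^sub>R real m \<in> P"
    by (auto simp: dilate_def intro: image_eqI[of _ _ "x /\<^sub>R real m"])
  also have "\<dots> \<longleftrightarrow> height F (x /\<^sub>R real m) \<le> 1"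
    by (rule in_P_iff[OF F cone_of_scale[OF _ x]]) simp
  finally show ?thesis using False by (simp add: height_scale field_simps)
qed

text \<open>The ray through a nonzero \<open>x\<close> leaves the bounded set \<open>P\<close> at a
  frontier point, which lies in some facet.\<close>

lemma cones_cover: "\<exists>F\<in>facets. x \<in> cone_of F"
proof -
  have *: "\<exists>F\<in>facets. x \<in> cone_of F" if "x \<noteq> 0" for x
  proof -
    obtain d where d: "d > 0" "0 + d *\<^sub>R x \<in> frontier P"
      using ray_to_frontier[OF polytope_imp_bounded[OF polytope] zero_interior \<open>x \<noteq> 0\<close>] by metis
    then obtain F where F: "F \<in> facets" "d *\<^sub>R x \<in> F"
      unfolding frontier_eq by auto
    then have "(1 / d) *\<^sub>R d *\<^sub>R x \<in> cone_of F"
      using d by (intro cone_of_scale facet_subset_cone) auto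
    then show ?thesis using d F by auto
  qed
  show ?thesis
  proof (cases "x = 0")
    \<comment> \<open>The origin lies in every cone, so only the existence of a facet is at stake; a
      unit vector supplies one.\<close>
    case True
    obtain F where "F \<in> facets" using *[of "axis undefined 1"] by (auto simp: axis_eq_0_iff)
    with True show ?thesis by (auto simp: cone_of_def)
  qed (rule *)
qed

lemma facets_nonempty: "facets \<noteq> {}"
  using cones_cover by auto

text \<open>Both heights give the gauge of \<open>x\<close>, so they agree there. Since
  \<open>x\<close> is a strictly positive combination of the vertices of \<open>F\<close>, on which
  \<open>height G\<close> is at most 1, equality forces \<open>height G = 1\<close> on all of them;
  then the two height functions coincide, and so do the facets.\<close>

lemma interior_cone_unique:
  assumes F: "F \<in> facets" and G: "G \<in> facets"
    and pos: "\<And>v. v \<in> vertices F \<Longrightarrow> coord F v x > 0" and xG: "x \<in> cone_of G"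
  shows "F = G"
proof -
  have xF: "x \<in> cone_of F" using pos by (simp add: cone_of_def less_imp_le)
  define s where "s = height F x"
  have "vertices F \<noteq> {}" using card_vertices[OF F] by auto
  then have "s > 0"
    unfolding s_def height_def using pos finite_vertices[OF F] by (intro sum_pos) auto
  have "x \<noteq> 0" using \<open>s > 0\<close> by (auto simp: s_def)
  define t where "t = height G x"
  have "t > 0" using height_eq_0[OF G xG] height_nonneg[OF xG] \<open>x \<noteq> 0\<close> by (auto simp: t_def less_le)
  have "x /\<^sub>R s \<in> P" using in_P_iff[OF F cone_of_scale[OF _ xF]] \<open>s > 0\<close> by (simp add: height_scale s_def)
  then have "t \<le> s" using facet_halfspace(2)[OF G, of "x /\<^sub>R s"] \<open>s > 0\<close>
    by (simp add: height_scale t_def field_simps)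
  have "x /\<^sub>R t \<in> P" using in_P_iff[OF G cone_of_scale[OF _ xG]] \<open>t > 0\<close> by (simp add: height_scale t_def)
  then have "s \<le> t" using facet_halfspace(2)[OF F, of "x /\<^sub>R t"] \<open>t > 0\<close>
    by (simp add: height_scale s_def field_simps)
  have ts: "t = s" using \<open>t \<le> s\<close> \<open>s \<le> t\<close> by simp
  have hG: "height G v \<le> 1" if "v \<in> vertices F" for v
    using facet_halfspace(2)[OF G, of v] vertices_facet_subset[OF F] that
    by (auto simp: vertices_def extreme_point_of_def)
  \<comment> \<open>The vector representing \<open>height G\<close> as an inner product, as
    \<open>linear_form_eq_height\<close> expects.\<close>
  define h where "h = (\<Sum>v\<in>vertices G. dual G v)"
  have h: "height G y = h \<bullet> y" for y
    by (simp add: h_def height_def coord_def inner_sum_right inner_commute[of _ y])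
  have "t = h \<bullet> (\<Sum>v\<in>vertices F. coord F v x *\<^sub>R v)"
    by (simp add: t_def h coord_expand[OF F])
  also have "\<dots> = (\<Sum>v\<in>vertices F. coord F v x * height G v)"
    by (simp add: inner_sum_right h)
  finally have "(\<Sum>v\<in>vertices F. coord F v x * (1 - height G v)) = 0"
    using ts by (simp add: s_def height_def right_diff_distrib sum_subtractf)
  moreover have "(\<Sum>v\<in>vertices F. coord F v x * (1 - height G v)) = 0 \<longleftrightarrow>
      (\<forall>v\<in>vertices F. coord F v x * (1 - height G v) = 0)"
    using hG pos by (intro sum_nonneg_eq_0_iff finite_vertices[OF F] mult_nonneg_nonneg) (auto simp: less_imp_le)
  ultimately have zero: "\<forall>v\<in>vertices F. coord F v x * (1 - height G v) = 0"
    by blast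
  have "h \<bullet> v = 1" if "v \<in> vertices F" for v
    using bspec[OF zero that] pos[OF that] by (simp flip: h)
  then have "height G y = height F y" for y
    using linear_form_eq_height[OF F, of h 1 y] h[of y] by simp
  then show ?thesis
    using facet_halfspace(1)[OF F] facet_halfspace(1)[OF G] by simp
qed

subsection \<open>Half-open decomposition and symmetry of the Ehrhart polynomial\<close>

definition generic :: "real ^ 'n \<Rightarrow> bool" where
  "generic y \<longleftrightarrow> (\<forall>F\<in>facets. \<forall>v\<in>vertices F. coord F v y \<noteq> 0)"

text \<open>The wall hyperplanes are finite in number, so their union is a null set.\<close>

lemma generic_exists: "\<exists>y. generic y"
proof -
  let ?S = "\<Union>F\<in>facets. \<Union>v\<in>vertices F. {y. dual F v \<bullet> y = 0}"
  have "negligible ?S"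
    by (intro negligible_Union finite_imageI finite_facets)
       (auto intro!: negligible_Union finite_imageI finite_vertices negligible_hyperplane dest: dual_nonzero)
  then have "?S \<noteq> UNIV" using non_negligible_UNIV by metis
  then obtain y where "y \<notin> ?S" by blast
  then have "generic y"
    by (auto simp: generic_def coord_def inner_commute)
  then show ?thesis ..
qed

lemma generic_minus: "generic y \<Longrightarrow> generic (- y)"
  by (simp add: generic_def coord_minus)

text \<open>A wall of the cone is kept where \<open>y\<close> points inward and dropped
  otherwise.\<close>

definition halfopen :: "real ^ 'n \<Rightarrow> (real ^ 'n) set \<Rightarrow> (real ^ 'n) set" where
  "halfopen y F =
     {x. \<forall>v\<in>vertices F. coord F v x > 0 \<or> coord F v x = 0 \<and> coord F v y > 0}"

lemma halfopen_subset_cone: "halfopen y F \<subseteq> cone_of F"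
  by (auto simp: halfopen_def cone_of_def)

lemma tendsto_coord_perturb:
  "((\<lambda>e. coord F v (x + e *\<^sub>R y)) \<longlongrightarrow> coord F v x) (at_right 0)"
proof -
  have "((\<lambda>e. coord F v x + e * coord F v y) \<longlongrightarrow> coord F v x + 0 * coord F v y) (at_right 0)"
    by (intro tendsto_intros)
  then show ?thesis by (simp add: coord_add coord_scale)
qed

text \<open>Each \<open>x + e y\<close> lies in some cone, and as there are finitely many, one cone
  contains it for arbitrarily small \<open>e > 0\<close>. A coordinate violating the half-open
  condition would be negative for all small \<open>e\<close>.\<close>

lemma halfopen_cover:
  assumes y: "generic y"
  shows "\<exists>F\<in>facets. x \<in> halfopen y F"
proof -
  have "\<exists>F\<in>facets. \<exists>\<^sub>F e in at_right 0. x + e *\<^sub>R y \<in> cone_of F"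
  proof (rule ccontr)
    assume "\<not> ?thesis"
    then have "\<forall>F\<in>facets. \<forall>\<^sub>F e in at_right (0::real). x + e *\<^sub>R y \<notin> cone_of F"
      by (simp add: frequently_def)
    then have "\<forall>\<^sub>F e in at_right (0::real). \<forall>F\<in>facets. x + e *\<^sub>R y \<notin> cone_of F"
      using finite_facets by (simp add: eventually_ball_finite)
    then obtain e where "\<forall>F\<in>facets. x + e *\<^sub>R y \<notin> cone_of F"
      using eventually_happens[of _ "at_right (0::real)"] by auto
    then show False using cones_cover by blast
  qed
  then obtain F where F: "F \<in> facets" and freq: "\<exists>\<^sub>F e in at_right 0. x + e *\<^sub>R y \<in> cone_of F"
    by blast
  have "coord F v x > 0 \<or> coord F v x = 0 \<and> coord F v y > 0" if v: "v \<in> vertices F" for v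
  proof (rule ccontr)
    assume neg: "\<not> ?thesis"
    have "coord F v y \<noteq> 0" using y F v by (simp add: generic_def)
    with neg consider "coord F v x < 0" | "coord F v x = 0" "coord F v y < 0" by linarith
    then have "\<forall>\<^sub>F e in at_right 0. coord F v (x + e *\<^sub>R y) < 0"
    proof cases
      case 1
      then show ?thesis using order_tendstoD(2)[OF tendsto_coord_perturb] by blast
    next
      case 2
      show ?thesis
        using eventually_at_right_less[of "0::real"]
        by eventually_elim (use 2 in \<open>simp add: coord_add coord_scale mult_pos_neg\<close>)
    qed
    then have "\<forall>\<^sub>F e in at_right 0. x + e *\<^sub>R y \<notin> cone_of F"
      by eventually_elim (use v in \<open>auto simp: cone_of_def not_le\<close>)
    with freq show False by (simp add: frequently_def)
  qed
  with F show ?thesis by (auto simp: halfopen_def)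
qed

lemma halfopen_eventually_interior:
  assumes F: "F \<in> facets" and x: "x \<in> halfopen y F"
  shows "\<forall>\<^sub>F e in at_right 0. \<forall>v\<in>vertices F. coord F v (x + e *\<^sub>R y) > 0"
proof (intro eventually_ball_finite finite_vertices[OF F] ballI)
  fix v assume "v \<in> vertices F"
  with x consider "coord F v x > 0" | "coord F v x = 0" "coord F v y > 0"
    by (auto simp: halfopen_def)
  then show "\<forall>\<^sub>F e in at_right 0. coord F v (x + e *\<^sub>R y) > 0"
  proof cases
    case 1
    then show ?thesis using order_tendstoD(1)[OF tendsto_coord_perturb] by blast
  next
    case 2
    show ?thesis
      using eventually_at_right_less[of "0::real"]
      by eventually_elim (use 2 in \<open>simp add: coord_add coord_scale\<close>)
  qed
qed

text \<open>One small push along \<open>y\<close> moves \<open>x\<close> into the interiors of both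
  cones.\<close>

lemma halfopen_unique:
  assumes F: "F \<in> facets" and G: "G \<in> facets"
    and x: "x \<in> halfopen y F" "x \<in> halfopen y G"
  shows "F = G"
proof -
  have "\<forall>\<^sub>F e in at_right (0::real). (\<forall>v\<in>vertices F. coord F v (x + e *\<^sub>R y) > 0) \<and>
      (\<forall>v\<in>vertices G. coord G v (x + e *\<^sub>R y) > 0)"
    by (intro eventually_conj halfopen_eventually_interior F G x)
  then have "\<exists>e. (\<forall>v\<in>vertices F. coord F v (x + e *\<^sub>R y) > 0) \<and>
      (\<forall>v\<in>vertices G. coord G v (x + e *\<^sub>R y) > 0)"
    by (rule eventually_happens'[rotated]) simp
  then obtain e :: real where e: "\<forall>v\<in>vertices F. coord F v (x + e *\<^sub>R y) > 0"
      "\<forall>v\<in>vertices G. coord G v (x + e *\<^sub>R y) > 0"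
    by blast
  then have "x + e *\<^sub>R y \<in> cone_of G"
    by (auto simp: cone_of_def less_imp_le)
  with e show ?thesis
    using interior_cone_unique[OF F G] by blast
qed

section \<open>Counting lattice points in the half-open cones\<close>

definition negs :: "real ^ 'n \<Rightarrow> (real ^ 'n) set \<Rightarrow> (real ^ 'n) set" where
  "negs y F = {v \<in> vertices F. coord F v y < 0}"

definition piece :: "real ^ 'n \<Rightarrow> nat \<Rightarrow> (real ^ 'n) set \<Rightarrow> (real ^ 'n) set" where
  "piece y m F = {x \<in> int_lattice. x \<in> halfopen y F \<and> height F x \<le> real m}"

lemma int_lattice_sum:
  assumes "\<And>v. v \<in> A \<Longrightarrow> v \<in> int_lattice"
  shows "(\<Sum>v\<in>A. real (a v) *\<^sub>R v) \<in> int_lattice"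
  using assms by (auto simp: int_lattice_def intro!: Ints_sum)

text \<open>Unimodularity makes lattice points the same as integer coordinate vectors, with the
  height as coordinate sum. Genericity leaves only two cases for each wall, and those in
  \<open>negs y F\<close> require a positive coordinate.\<close>

lemma bij_betw_piece:
  assumes F: "F \<in> facets" and y: "generic y"
  shows "bij_betw (\<lambda>a. \<Sum>v\<in>vertices F. real (a v) *\<^sub>R v)
    (bounded_sums (vertices F) (negs y F) m) (piece y m F)"
proof (rule bij_betwI[where g = "\<lambda>x. \<lambda>v\<in>vertices F. nat \<lfloor>coord F v x\<rfloor>"])
  let ?f = "\<lambda>a::real^'n \<Rightarrow> nat. \<Sum>v\<in>vertices F. real (a v) *\<^sub>R v"
  let ?g = "\<lambda>x. \<lambda>v\<in>vertices F. nat \<lfloor>coord F v x\<rfloor>"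
  have cf: "coord F v (?f a) = real (a v)" if "v \<in> vertices F" for v a
    by (rule coord_combination[OF F that])
  have hf: "height F (?f a) = real (sum a (vertices F))" for a
    by (simp add: height_def cf)
  \<comment> \<open>On a piece the coordinates are nonnegative integers, so neither
    \<open>nat\<close> nor the floor changes them.\<close>
  have cg: "real (?g x v) = coord F v x" if "x \<in> piece y m F" "v \<in> vertices F" for x v
  proof -
    have "coord F v x \<ge> 0" using that by (auto simp: piece_def halfopen_def)
    moreover have "coord F v x \<in> \<int>" using that coord_Ints[OF F] by (simp add: piece_def)
    ultimately show ?thesis using that(2) by (auto elim: Ints_cases)
  qed
  show "?f \<in> bounded_sums (vertices F) (negs y F) m \<rightarrow> piece y m F"
  proof
    fix a assume a: "a \<in> bounded_sums (vertices F) (negs y F) m"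
    have "?f a \<in> int_lattice"
      using lattice_vertices vertices_facet_subset[OF F] by (intro int_lattice_sum) blast
    moreover have "?f a \<in> halfopen y F"
      unfolding halfopen_def
    proof (intro CollectI ballI)
      fix v assume v: "v \<in> vertices F"
      have "coord F v y \<noteq> 0" using y F v by (simp add: generic_def)
      moreover have "coord F v y < 0 \<Longrightarrow> a v > 0"
        using a v by (simp add: bounded_sums_def negs_def)
      ultimately show "0 < coord F v (?f a) \<or> coord F v (?f a) = 0 \<and> 0 < coord F v y"
        unfolding cf[OF v] by (cases "a v = 0") (auto simp: neq_iff)
    qed
    moreover have "height F (?f a) \<le> real m"
      unfolding hf using a by (simp only: bounded_sums_def mem_Collect_eq of_nat_le_iff)
    ultimately show "?f a \<in> piece y m F" by (simp add: piece_def)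
  qed
  show "?g \<in> piece y m F \<rightarrow> bounded_sums (vertices F) (negs y F) m"
  proof
    fix x assume x: "x \<in> piece y m F"
    have "?g x v > 0" if "v \<in> negs y F" for v
    proof -
      have v: "v \<in> vertices F" using that by (simp add: negs_def)
      have "coord F v x > 0" using x that by (auto simp: piece_def halfopen_def negs_def)
      then have "real (?g x v) > 0" by (simp only: cg[OF x v])
      then show ?thesis by (simp only: of_nat_0_less_iff)
    qed
    moreover have "real (sum (?g x) (vertices F)) = height F x"
      unfolding of_nat_sum height_def by (intro sum.cong cg x refl)
    then have "sum (?g x) (vertices F) \<le> m"
      using x by (simp only: piece_def mem_Collect_eq flip: of_nat_le_iff[where ?'a = real])
    ultimately show "?g x \<in> bounded_sums (vertices F) (negs y F) m"
      by (simp add: bounded_sums_def)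
  qed
  show "?g (?f a) = a" if "a \<in> bounded_sums (vertices F) (negs y F) m" for a
    using that by (auto simp: bounded_sums_def fun_eq_iff cf PiE_iff extensional_def)
  show "?f (?g x) = x" if "x \<in> piece y m F" for x
  proof -
    have "?f (?g x) = (\<Sum>v\<in>vertices F. coord F v x *\<^sub>R v)"
      by (intro sum.cong refl) (simp only: cg[OF that])
    then show ?thesis by (simp only: coord_expand[OF F])
  qed
qed

lemma finite_negs: "F \<in> facets \<Longrightarrow> finite (negs y F)"
  by (simp add: negs_def finite_vertices)

lemma card_negs_le: "F \<in> facets \<Longrightarrow> card (negs y F) \<le> CARD('n)"
  unfolding card_vertices[symmetric] by (rule card_mono) (auto simp: negs_def finite_vertices)

text \<open>No coordinate of a generic \<open>y\<close> is 0, so negation exchanges the negative and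
  the positive ones.\<close>

lemma card_negs_minus:
  assumes F: "F \<in> facets" and y: "generic y"
  shows "card (negs (- y) F) = CARD('n) - card (negs y F)"
proof -
  have "negs (- y) F = vertices F - negs y F"
    using y F by (force simp: negs_def coord_minus generic_def)
  moreover have "negs y F \<subseteq> vertices F" by (auto simp: negs_def)
  ultimately show ?thesis
    by (simp add: card_Diff_subset finite_negs[OF F] card_vertices[OF F])
qed

lemma dilate_lattice_eq:
  assumes y: "generic y"
  shows "dilate m P \<inter> int_lattice = (\<Union>F\<in>facets. piece y m F)"
proof (intro set_eqI iffI)
  fix x assume x: "x \<in> dilate m P \<inter> int_lattice"
  obtain F where F: "F \<in> facets" "x \<in> halfopen y F" using halfopen_cover[OF y] by blast
  then have "height F x \<le> real m"
    using x in_dilate_iff[OF F(1), of x m] halfopen_subset_cone by blast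
  with x F show "x \<in> (\<Union>F\<in>facets. piece y m F)" by (auto simp: piece_def)
next
  fix x assume "x \<in> (\<Union>F\<in>facets. piece y m F)"
  then obtain F where "F \<in> facets" "x \<in> piece y m F" by blast
  then show "x \<in> dilate m P \<inter> int_lattice"
    using in_dilate_iff[of F x m] halfopen_subset_cone[of y F] by (auto simp: piece_def)
qed

lemma finite_piece: "F \<in> facets \<Longrightarrow> generic y \<Longrightarrow> finite (piece y m F)"
  using bij_betw_finite[OF bij_betw_piece] finite_bounded_sums[OF finite_vertices] by blast

lemma finite_dilate_lattice: "finite (dilate m P \<inter> int_lattice)"
  using generic_exists by (auto simp: dilate_lattice_eq finite_facets finite_piece)

lemma card_dilate_lattice:
  assumes y: "generic y"
  shows "card (dilate m P \<inter> int_lattice) =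
    (\<Sum>F\<in>facets. (m + CARD('n) - card (negs y F)) choose CARD('n))"
proof -
  have "piece y m F \<inter> piece y m G = {}" if "F \<in> facets" "G \<in> facets" "F \<noteq> G" for F G
    using halfopen_unique[OF that(1,2)] that(3) by (auto simp: piece_def)
  then have "card (dilate m P \<inter> int_lattice) = (\<Sum>F\<in>facets. card (piece y m F))"
    using y by (simp add: dilate_lattice_eq card_UN_disjoint finite_facets finite_piece)
  also have "\<dots> = (\<Sum>F\<in>facets. (m + CARD('n) - card (negs y F)) choose CARD('n))"
  proof (rule sum.cong)
    fix F assume F: "F \<in> facets"
    have "card (piece y m F) = card (bounded_sums (vertices F) (negs y F) m)"
      using bij_betw_same_card[OF bij_betw_piece[OF F y]] by simp
    also have "\<dots> = (m + CARD('n) - card (negs y F)) choose CARD('n)"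
      using card_bounded_sums[OF finite_vertices[OF F], of "negs y F" m]
      by (auto simp: card_vertices[OF F] negs_def)
    finally show "card (piece y m F) = (m + CARD('n) - card (negs y F)) choose CARD('n)" .
  qed simp
  finally show ?thesis .
qed

section \<open>The Ehrhart polynomial: formula, symmetry and leading coefficient\<close>

definition sum_poly :: "real ^ 'n \<Rightarrow> real poly" where
  "sum_poly y = (\<Sum>F\<in>facets. choose_poly CARD('n) (CARD('n) - card (negs y F)))"

lemma poly_sum_poly:
  assumes "generic y"
  shows "poly (sum_poly y) (real m) = real (card (dilate m P \<inter> int_lattice))"
  unfolding sum_poly_def card_dilate_lattice[OF assms] poly_sum of_nat_sum
  by (intro sum.cong refl)
     (simp add: poly_choose_poly binomial_gbinomial of_nat_diff card_negs_le add_diff_eq trans_le_add2)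

lemma ehrhart_poly_eq:
  assumes "generic y"
  shows "ehrhart_poly P = sum_poly y"
  unfolding ehrhart_poly_def
  by (rule the_equality) (use assms in \<open>auto intro!: poly_eqI_nat simp: poly_sum_poly\<close>)

text \<open>The definition of \<open>ehrhart_poly\<close> constrains only \<open>m \<ge> 1\<close>;
  the half-open count holds at \<open>m = 0\<close> as well, which later yields the constant
  term.\<close>

lemma poly_ehrhart: "poly (ehrhart_poly P) (real m) = real (card (dilate m P \<inter> int_lattice))"
  using generic_exists ehrhart_poly_eq poly_sum_poly by metis

text \<open>The directions \<open>y\<close> and \<open>- y\<close> give two formulas for the same
  polynomial, and their summands correspond under \<open>poly_choose_poly_reflect\<close>.\<close>

lemma ehrhart_reflect:
  "poly (ehrhart_poly P) (- 1 - x) = (- 1) ^ CARD('n) * poly (ehrhart_poly P) x"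
proof -
  obtain y where y: "generic y" using generic_exists ..
  have "poly (sum_poly y) (- 1 - x) = (- 1) ^ CARD('n) * poly (sum_poly (- y)) x"
    unfolding sum_poly_def poly_sum sum_distrib_left
    by (intro sum.cong refl)
       (simp add: poly_choose_poly_reflect card_negs_le card_negs_minus[OF _ y])
  then show ?thesis
    using ehrhart_poly_eq[OF y] ehrhart_poly_eq[OF generic_minus[OF y]] by simp
qed

lemma degree_ehrhart: "degree (ehrhart_poly P) \<le> CARD('n)"
  using generic_exists
  by (auto simp: ehrhart_poly_eq sum_poly_def intro!: degree_sum_le finite_facets degree_choose_poly_le)

text \<open>Every half-open cone contributes \<open>1 / fact d\<close> with
  \<open>d = CARD('n)\<close>, so no cancellation can occur.\<close>

lemma coeff_ehrhart: "coeff (ehrhart_poly P) CARD('n) = real (card facets) / fact CARD('n)"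
  using generic_exists by (auto simp: ehrhart_poly_eq sum_poly_def coeff_sum coeff_choose_poly)

lemma coeff_ehrhart_nonzero: "coeff (ehrhart_poly P) CARD('n) \<noteq> 0"
  by (simp add: coeff_ehrhart finite_facets facets_nonempty)

section \<open>Lattice points of P, of 2P and of the boundary of 2P\<close>

lemma dilate_1: "dilate 1 P = P"
  by (simp add: dilate_def)

lemma zero_notin_vertices: "0 \<notin> vertices P"
  unfolding vertices_def using extreme_point_not_in_interior[of 0 P] zero_interior by blast

text \<open>In the cone containing \<open>x\<close> the coordinates are nonnegative integers with
  sum at most 1, so at most one is nonzero and it equals 1.\<close>

lemma lattice_points: "P \<inter> int_lattice = insert 0 (vertices P)"
proof (intro set_eqI iffI)
  fix x assume x: "x \<in> P \<inter> int_lattice"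
  obtain F where F: "F \<in> facets" "x \<in> cone_of F" using cones_cover by blast
  show "x \<in> insert 0 (vertices P)"
  proof (cases "x = 0")
    case False
    have "\<exists>u\<in>vertices F. coord F u x \<noteq> 0"
      using coord_expand[OF F(1), of x] False by (metis (no_types, lifting) scaleR_zero_left sum.neutral)
    then obtain u where u: "u \<in> vertices F" "coord F u x \<noteq> 0" by blast
    have "coord F u x \<in> \<int>" "coord F u x \<ge> 0"
      using coord_Ints[OF F(1) u(1)] x F(2) u by (auto simp: cone_of_def)
    with u(2) have u1: "coord F u x \<ge> 1" by (auto elim!: Ints_cases)
    have fin: "finite (vertices F)" by (rule finite_vertices[OF F(1)])
    have "height F x = coord F u x + (\<Sum>v\<in>vertices F - {u}. coord F v x)"
      unfolding height_def by (rule sum.remove[OF fin u(1)])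
    moreover have "height F x \<le> 1" using x in_P_iff[OF F] by blast
    moreover have nn: "(\<Sum>v\<in>vertices F - {u}. coord F v x) \<ge> 0"
      using F(2) by (intro sum_nonneg) (auto simp: cone_of_def)
    ultimately have *: "coord F u x = 1" "(\<Sum>v\<in>vertices F - {u}. coord F v x) = 0" using u1 by linarith+
    have "(\<Sum>v\<in>vertices F - {u}. coord F v x) = 0 \<longleftrightarrow> (\<forall>v\<in>vertices F - {u}. coord F v x = 0)"
      by (rule sum_nonneg_eq_0_iff) (use F(2) fin in \<open>auto simp: cone_of_def\<close>)
    with *(2) have rest: "\<forall>v\<in>vertices F - {u}. coord F v x = 0" by blast
    have "x = (\<Sum>v\<in>vertices F. coord F v x *\<^sub>R v)" by (simp only: coord_expand[OF F(1)])
    also have "\<dots> = coord F u x *\<^sub>R u + (\<Sum>v\<in>vertices F - {u}. coord F v x *\<^sub>R v)"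
      by (rule sum.remove[OF fin u(1)])
    also have "\<dots> = u" using rest by (simp add: *(1))
    finally have "x = u" .
    then show ?thesis using u vertices_facet_subset[OF F(1)] by blast
  qed simp
next
  fix x assume "x \<in> insert 0 (vertices P)"
  moreover have "0 \<in> (int_lattice :: (real ^ 'n) set)" by (simp add: int_lattice_def)
  ultimately show "x \<in> P \<inter> int_lattice"
    using zero_in lattice_vertices by (auto simp: vertices_def extreme_point_of_def)
qed

lemma finite_vertices_P: "finite (vertices P)"
  unfolding vertices_def by (rule finite_polyhedron_extreme_points[OF polyhedron])

text \<open>If a frontier point on a facet \<open>G\<close> had \<open>s = height F x < 1\<close>,
  then \<open>x / s\<close> would still lie in \<open>P\<close> but have height
  \<open>1 / s > 1\<close> over \<open>G\<close>.\<close>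

lemma frontier_P_iff:
  assumes F: "F \<in> facets" and x: "x \<in> cone_of F"
  shows "x \<in> frontier P \<longleftrightarrow> height F x = 1"
proof
  assume "x \<in> frontier P"
  then obtain G where G: "G \<in> facets" "x \<in> G" unfolding frontier_eq by blast
  then have xG: "x \<in> P" "height G x = 1" using facet_halfspace(1)[OF G(1)] by blast+
  define s where "s = height F x"
  have "s \<le> 1" using facet_halfspace(2)[OF F xG(1)] by (simp add: s_def)
  have "s > 0" using height_nonneg[OF x] height_eq_0[OF F x] xG(2) by (fastforce simp: s_def less_le)
  have "x /\<^sub>R s \<in> P"
    using in_P_iff[OF F cone_of_scale[OF _ x]] \<open>s > 0\<close> by (simp add: height_scale s_def)
  then have "1 / s \<le> 1"
    using facet_halfspace(2)[OF G(1), of "x /\<^sub>R s"] xG(2) by (simp add: height_scale divide_inverse)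
  with \<open>s \<le> 1\<close> \<open>s > 0\<close> show "height F x = 1" by (simp add: s_def)
next
  assume h: "height F x = 1"
  then have "x \<in> F" using in_P_iff[OF F x] facet_halfspace(1)[OF F] by auto
  then show "x \<in> frontier P" using F frontier_eq by blast
qed

lemma frontier_dilate_2: "frontier (dilate 2 P) = (\<lambda>x. 2 *\<^sub>R x) ` frontier P"
proof -
  have cl: "closed P" by (simp add: polytope polytope_imp_closed)
  have "interior ((\<lambda>x. 2 *\<^sub>R x) ` P) = (\<lambda>x. 2 *\<^sub>R x) ` interior P"
    by (rule interior_injective_linear_image) (auto simp: inj_on_def linear_scale_self)
  moreover have "closed ((\<lambda>x. 2 *\<^sub>R x) ` P)" by (rule closed_scaling[OF cl])
  ultimately show ?thesis
    unfolding dilate_def frontier_def using cl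
    by (simp add: image_set_diff inj_on_def)
qed

lemma frontier_dilate_2_iff:
  assumes F: "F \<in> facets" and x: "x \<in> cone_of F"
  shows "x \<in> frontier (dilate 2 P) \<longleftrightarrow> height F x = 2"
proof -
  have "x \<in> frontier (dilate 2 P) \<longleftrightarrow> (1 / 2) *\<^sub>R x \<in> frontier P"
    unfolding frontier_dilate_2 by (auto intro: image_eqI[of _ _ "(1 / 2) *\<^sub>R x"])
  also have "\<dots> \<longleftrightarrow> height F ((1 / 2) *\<^sub>R x) = 1"
    by (rule frontier_P_iff[OF F cone_of_scale[OF _ x]]) simp
  finally show ?thesis by (simp add: height_scale)
qed

lemma height_Ints: "F \<in> facets \<Longrightarrow> x \<in> int_lattice \<Longrightarrow> height F x \<in> \<int>"
  unfolding height_def by (intro Ints_sum coord_Ints)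

text \<open>Heights of lattice points are integers, so in the dilate a height is either at most 1,
  inside \<open>P\<close>, or exactly 2, on the frontier.\<close>

lemma lattice_points_dilate_2:
  "dilate 2 P \<inter> int_lattice = (P \<inter> int_lattice) \<union> (frontier (dilate 2 P) \<inter> int_lattice)"
  and lattice_points_disjoint_frontier:
    "(P \<inter> int_lattice) \<inter> (frontier (dilate 2 P) \<inter> int_lattice) = {}"
proof -
  have "(x \<in> dilate 2 P \<longleftrightarrow> x \<in> P \<or> x \<in> frontier (dilate 2 P)) \<and>
      \<not> (x \<in> P \<and> x \<in> frontier (dilate 2 P))"
    if "x \<in> int_lattice" for x
  proof -
    obtain F where F: "F \<in> facets" "x \<in> cone_of F" using cones_cover by blast
    have "height F x \<le> 2 \<longleftrightarrow> height F x \<le> 1 \<or> height F x = 2"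
      using height_Ints[OF F(1) that] by (auto elim!: Ints_cases)
    then show ?thesis
      using in_P_iff[OF F] in_dilate_iff[OF F, of 2] frontier_dilate_2_iff[OF F] by auto
  qed
  then show "dilate 2 P \<inter> int_lattice = (P \<inter> int_lattice) \<union> (frontier (dilate 2 P) \<inter> int_lattice)"
    and "(P \<inter> int_lattice) \<inter> (frontier (dilate 2 P) \<inter> int_lattice) = {}"
    by blast+
qed

lemma ehrhart_0: "poly (ehrhart_poly P) 0 = 1"
proof -
  have "dilate 0 P \<inter> int_lattice = {0}"
    using zero_in by (auto simp: dilate_def int_lattice_def)
  then show ?thesis using poly_ehrhart[of 0] by simp
qed

lemma ehrhart_1: "poly (ehrhart_poly P) 1 = 1 + real (card (vertices P))"
  using poly_ehrhart[of 1, unfolded dilate_1 lattice_points]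
  by (simp add: finite_vertices_P zero_notin_vertices)

lemma ehrhart_2: "poly (ehrhart_poly P) 2 =
    1 + real (card (vertices P)) + real (card (frontier (dilate 2 P) \<inter> int_lattice))"
proof -
  have "finite (frontier (dilate 2 P) \<inter> int_lattice)" "finite (P \<inter> int_lattice)"
    using finite_dilate_lattice[of 2] by (simp_all add: lattice_points_dilate_2)
  then have "card (dilate 2 P \<inter> int_lattice) =
      card (P \<inter> int_lattice) + card (frontier (dilate 2 P) \<inter> int_lattice)"
    unfolding lattice_points_dilate_2 by (intro card_Un_disjoint lattice_points_disjoint_frontier)
  then show ?thesis
    using poly_ehrhart[of 2] by (simp add: lattice_points finite_vertices_P zero_notin_vertices)
qed

end

subsection \<open>Roots of polynomials with a reflection symmetry\<close>

lemma poly_eq_pCons5: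
  assumes "degree p \<le> 5"
  shows "p = [:coeff p 0, coeff p 1, coeff p 2, coeff p 3, coeff p 4, coeff p 5:]"
  using assms by (intro poly_eqI) (auto simp: coeff_pCons coeff_eq_0 eval_nat_numeral split: nat.split)

text \<open>Nonnegativity of \<open>D\<close> is recorded too, so that \<open>sqrt D\<close> is a
  genuine square root.\<close>

lemma eq_plus_minus_sqrt:
  fixes x A D :: real
  assumes "(x - A)\<^sup>2 = D"
  shows "D \<ge> 0 \<and> (x = A + sqrt D \<or> x = A - sqrt D)"
  using assms by (auto simp: abs_if)

context
  fixes p :: "real poly" and \<beta> f0 b2 :: real and d :: nat
  assumes deg: "degree p \<le> d" and lead: "coeff p d \<noteq> 0"
    and refl: "\<And>x. poly p (- 1 - x) = (- 1) ^ d * poly p x"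
    and val: "poly p 0 = 1" "poly p 1 = 1 + f0" "poly p 2 = 1 + f0 + b2"
    and root: "poly (map_poly complex_of_real p) (- 1 / 2 + complex_of_real \<beta> * \<i>) = 0"
begin

text \<open>Symmetry forces \<open>p = 1 + (f0 / 2) t (t + 1)\<close>; a nonzero leading coefficient
  gives \<open>f0 \<noteq> 0\<close>.\<close>

lemma reflected_root_2:
  assumes d: "d = 2"
  shows "f0 \<noteq> 0 \<and> \<beta>\<^sup>2 = - 1 / 4 + 2 / f0"
proof -
  define a b where "a = coeff p 2" and "b = coeff p 1"
  have p: "p = [:coeff p 0, b, a:]"
    using poly_eq_pCons5[of p] deg by (simp add: d a_def b_def coeff_eq_0)
  have c0: "coeff p 0 = 1" using val(1) by (subst (asm) p) simp
  have p1: "p = [:1, b, a:]" using p c0 by simp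
  have "a = b" using refl[of 0] unfolding p1 by (simp add: d)
  moreover have "a + b = f0" using val(2) unfolding p1 by simp
  ultimately have ab: "a = f0 / 2" "b = f0 / 2" by auto
  have f0: "f0 \<noteq> 0" using lead ab by (simp add: d a_def)
  have "1 - f0 / 2 * (\<beta>\<^sup>2 + 1 / 4) = 0"
    using root unfolding p1 ab by (simp add: map_poly_pCons complex_eq_iff power2_eq_square field_simps)
  then show ?thesis using f0 by (simp add: field_simps)
qed

lemma reflected_root_3:
  assumes d: "d = 3"
  shows "\<beta> = 0 \<or> (f0 - 2 \<noteq> 0 \<and> \<beta>\<^sup>2 = - 1 / 4 + 6 / (f0 - 2))"
proof -
  define a b c where "a = coeff p 3" and "b = coeff p 2" and "c = coeff p 1"
  have p: "p = [:coeff p 0, c, b, a:]"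
    using poly_eq_pCons5[of p] deg by (simp add: d a_def b_def c_def coeff_eq_0)
  have c0: "coeff p 0 = 1" using val(1) by (subst (asm) p) simp
  have p1: "p = [:1, c, b, a:]" using p c0 by simp
  \<comment> \<open>The symmetric form is \<open>(2 t + 1) (1 + B t (t + 1))\<close>, and its value
    at \<open>t = 1\<close> determines \<open>B\<close>.\<close>
  define B where "B = (f0 - 2) / 6"
  have "1 - c + b - a = -1" using refl[of 0] unfolding p1 by (simp add: d)
  moreover have "1 - 2 * c + 4 * b - 8 * a = - (1 + c + b + a)"
    using refl[of 1] unfolding p1 by (simp add: d)
  moreover have "a + b + c = f0" using val(2) unfolding p1 by simp
  ultimately have ab: "a = 2 * B" "b = 3 * B" "c = 2 + B"
    unfolding B_def by argo+
  have f0: "f0 - 2 \<noteq> 0" using lead ab by (simp add: d a_def B_def)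
  \<comment> \<open>At the root \<open>2 t + 1\<close> is \<open>2 \<beta> \<i>\<close> and the
    other factor is real, so the imaginary part carries the equation.\<close>
  have "\<beta> * (1 - B * (\<beta>\<^sup>2 + 1 / 4)) = 0"
    using root unfolding p1 ab by (simp add: map_poly_pCons complex_eq_iff power2_eq_square algebra_simps)
  then have "\<beta> = 0 \<or> 1 - B * (\<beta>\<^sup>2 + 1 / 4) = 0" by simp
  then show ?thesis using f0 by (auto simp: B_def field_simps)
qed

lemma reflected_root_4:
  assumes d: "d = 4"
  shows "let N = b2 - 2 * f0;
             A = - 17 / 4 + 3 * b2 / N;
             D = 1 - 12 * (f0 + 2) / N + 36 * f0\<^sup>2 / N\<^sup>2
         in N \<noteq> 0 \<and> D \<ge> 0 \<and> (\<beta>\<^sup>2 = A + sqrt D \<or> \<beta>\<^sup>2 = A - sqrt D)"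
proof -
  define a4 a3 a2 a1 where "a4 = coeff p 4" and "a3 = coeff p 3" and "a2 = coeff p 2" and "a1 = coeff p 1"
  have p: "p = [:coeff p 0, a1, a2, a3, a4:]"
    using poly_eq_pCons5[of p] deg by (simp add: d a4_def a3_def a2_def a1_def coeff_eq_0)
  have c0: "coeff p 0 = 1" using val(1) by (subst (asm) p) simp
  have p1: "p = [:1, a1, a2, a3, a4:]" using p c0 by simp
  define N where "N = b2 - 2 * f0"
  \<comment> \<open>With \<open>u = t (t + 1)\<close> the polynomial is
    \<open>1 + C u + B u^2\<close>; \<open>u = 2\<close> and \<open>u = 6\<close> at
    \<open>t = 1\<close> and \<open>t = 2\<close> determine \<open>B\<close> and
    \<open>C\<close>.\<close>
  define B C where "B = N / 24" and "C = f0 / 2 - N / 12"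
  have "- a1 + a2 - a3 + a4 = 0" using refl[of 0] unfolding p1 by (simp add: d)
  moreover have "- 2 * a1 + 4 * a2 - 8 * a3 + 16 * a4 = a1 + a2 + a3 + a4"
    using refl[of 1] unfolding p1 by (simp add: d)
  moreover have "a1 + a2 + a3 + a4 = f0" using val(2) unfolding p1 by simp
  moreover have "2 * a1 + 4 * a2 + 8 * a3 + 16 * a4 = f0 + b2" using val(3) unfolding p1 by simp
  ultimately have a: "a4 = B" "a3 = 2 * B" "a2 = C + B" "a1 = C"
    unfolding B_def C_def N_def by argo+
  have N: "N \<noteq> 0" using lead a by (simp add: d a4_def B_def)
  define w where "w = \<beta>\<^sup>2 + 1 / 4"
  have "1 - C * w + B * w\<^sup>2 = 0"
    using root unfolding p1 a w_def by (simp add: map_poly_pCons complex_eq_iff power2_eq_square field_simps)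
  then have w: "w\<^sup>2 = (C * w - 1) / B"
    using N by (simp add: B_def field_simps)
  \<comment> \<open>Completing the square: \<open>6 * f0 / N - 1\<close> is
    \<open>C / (2 B)\<close>, the centre of the quadratic in \<open>w\<close>. The stated centre
    agrees after the shift by \<open>1 / 4\<close>, because \<open>b2 = N + 2 * f0\<close>.\<close>
  have "(\<beta>\<^sup>2 - (- 17 / 4 + 3 * b2 / N))\<^sup>2 = (w - (6 * f0 / N - 1))\<^sup>2"
    using N by (simp add: w_def N_def field_simps)
  also have "\<dots> = 1 - 12 * (f0 + 2) / N + 36 * f0\<^sup>2 / N\<^sup>2"
    unfolding power2_diff w using N by (simp add: B_def C_def field_simps power2_eq_square)
  finally show ?thesis
    using N eq_plus_minus_sqrt unfolding Let_def N_def by blast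
qed

lemma reflected_root_5:
  assumes d: "d = 5"
  shows "\<beta> = 0 \<or>
        (let N = 6 + b2 - 4 * f0;
             A = - 5 / 4 + 10 * (f0 - 2) / N;
             D = 1 - 20 * (f0 + 4) / N + 100 * (f0 - 2)\<^sup>2 / N\<^sup>2
         in N \<noteq> 0 \<and> D \<ge> 0 \<and> (\<beta>\<^sup>2 = A + sqrt D \<or> \<beta>\<^sup>2 = A - sqrt D))"
proof (cases "\<beta> = 0")
  case False
  define a5 a4 a3 a2 a1 where "a5 = coeff p 5" and "a4 = coeff p 4" and "a3 = coeff p 3"
    and "a2 = coeff p 2" and "a1 = coeff p 1"
  have p: "p = [:coeff p 0, a1, a2, a3, a4, a5:]"
    using poly_eq_pCons5[of p] deg by (simp add: d a5_def a4_def a3_def a2_def a1_def)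
  have c0: "coeff p 0 = 1" using val(1) by (subst (asm) p) simp
  have p1: "p = [:1, a1, a2, a3, a4, a5:]" using p c0 by simp
  define N where "N = 6 + b2 - 4 * f0"
  \<comment> \<open>Here the form is \<open>(2 t + 1) (1 + C u + B u^2)\<close> with
    \<open>u = t (t + 1)\<close>, and the values at 1 and 2 again determine \<open>B\<close> and
    \<open>C\<close>.\<close>
  define B C where "B = N / 120" and "C = (f0 - 2) / 6 - N / 60"
  have "1 - a1 + a2 - a3 + a4 - a5 = - 1" using refl[of 0] unfolding p1 by (simp add: d)
  moreover have "1 - 2 * a1 + 4 * a2 - 8 * a3 + 16 * a4 - 32 * a5 = - (1 + a1 + a2 + a3 + a4 + a5)"
    using refl[of 1] unfolding p1 by (simp add: d)
  moreover have "1 - 3 * a1 + 9 * a2 - 27 * a3 + 81 * a4 - 243 * a5 =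
      - (1 + 2 * a1 + 4 * a2 + 8 * a3 + 16 * a4 + 32 * a5)"
    using refl[of 2] unfolding p1 by (simp add: d)
  moreover have "a1 + a2 + a3 + a4 + a5 = f0" using val(2) unfolding p1 by simp
  moreover have "2 * a1 + 4 * a2 + 8 * a3 + 16 * a4 + 32 * a5 = f0 + b2"
    using val(3) unfolding p1 by simp
  ultimately have a: "a5 = 2 * B" "a4 = 5 * B" "a3 = 2 * C + 4 * B" "a2 = 3 * C + B" "a1 = 2 + C"
    unfolding B_def C_def N_def by argo+
  have N: "N \<noteq> 0" using lead a by (simp add: d a5_def B_def)
  define w where "w = \<beta>\<^sup>2 + 1 / 4"
  have "\<beta> * (1 - C * w + B * w\<^sup>2) = 0"
    using root unfolding p1 a w_def by (simp add: map_poly_pCons complex_eq_iff power2_eq_square field_simps)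
  then have "1 - C * w + B * w\<^sup>2 = 0"
    using False by simp
  then have w: "w\<^sup>2 = (C * w - 1) / B"
    using N by (simp add: B_def field_simps)
  \<comment> \<open>The centre \<open>C / (2 B)\<close> of the quadratic in \<open>w\<close> is now
    \<open>10 * (f0 - 2) / N - 1\<close>.\<close>
  have "(\<beta>\<^sup>2 - (- 5 / 4 + 10 * (f0 - 2) / N))\<^sup>2 = (w - (10 * (f0 - 2) / N - 1))\<^sup>2"
    by (rule arg_cong[of _ _ "\<lambda>x. x\<^sup>2"]) (simp add: w_def)
  also have "\<dots> = 1 - 20 * (f0 + 4) / N + 100 * (f0 - 2)\<^sup>2 / N\<^sup>2"
    unfolding power2_diff[of w] w using N by (simp add: B_def C_def field_simps power2_eq_square)
  finally show ?thesis
    using N eq_plus_minus_sqrt unfolding Let_def N_def by blast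
qed simp

end

theorem theorem1p6:
  fixes P :: "(real ^ 'n) set" and f0 b2 \<beta> :: real and z :: complex
  assumes "smooth_polytope P"
    and "f0 = real (card (vertices P))"
    and "b2 = real (card (frontier (dilate 2 P) \<inter> int_lattice))"
    and "z = - 1 / 2 + complex_of_real \<beta> * \<i>"
    and "poly (map_poly complex_of_real (ehrhart_poly P)) z = 0"
  shows
    "(CARD('n) = 2 \<longrightarrow>
        f0 \<noteq> 0 \<and> \<beta>\<^sup>2 = - 1 / 4 + 2 / f0) \<and>
     (CARD('n) = 3 \<longrightarrow>
        \<beta> = 0 \<or> (f0 - 2 \<noteq> 0 \<and> \<beta>\<^sup>2 = - 1 / 4 + 6 / (f0 - 2))) \<and>
     (CARD('n) = 4 \<longrightarrow>
        (let N = b2 - 2 * f0;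
             A = - 17 / 4 + 3 * b2 / N;
             D = 1 - 12 * (f0 + 2) / N + 36 * f0\<^sup>2 / N\<^sup>2
         in N \<noteq> 0 \<and> D \<ge> 0 \<and> (\<beta>\<^sup>2 = A + sqrt D \<or> \<beta>\<^sup>2 = A - sqrt D))) \<and>
     (CARD('n) = 5 \<longrightarrow>
        \<beta> = 0 \<or>
        (let N = 6 + b2 - 4 * f0;
             A = - 5 / 4 + 10 * (f0 - 2) / N;
             D = 1 - 20 * (f0 + 4) / N + 100 * (f0 - 2)\<^sup>2 / N\<^sup>2
         in N \<noteq> 0 \<and> D \<ge> 0 \<and> (\<beta>\<^sup>2 = A + sqrt D \<or> \<beta>\<^sup>2 = A - sqrt D)))"
proof -
  interpret smooth P by unfold_locales (fact assms(1))
  have val: "poly (ehrhart_poly P) 1 = 1 + f0" "poly (ehrhart_poly P) 2 = 1 + f0 + b2"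
    unfolding assms(2,3) by (fact ehrhart_1, fact ehrhart_2)
  have root: "poly (map_poly complex_of_real (ehrhart_poly P)) (- 1 / 2 + complex_of_real \<beta> * \<i>) = 0"
    using assms(5) unfolding assms(4) .
  \<comment> \<open>These match the assumptions of the root lemmas in order, with
    \<open>CARD('n)\<close> for \<open>d\<close>.\<close>
  note facts = degree_ehrhart coeff_ehrhart_nonzero ehrhart_reflect ehrhart_0 val root
  show ?thesis
    by (intro conjI impI reflected_root_2[OF facts] reflected_root_3[OF facts]
        reflected_root_4[OF facts] reflected_root_5[OF facts])
qed

end
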